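(* Let $\mathcal X=\operatorname{conv}\{v_1,\dots,v_N\}$ be a polytope in a Euclidean space with $N$ vertices $v_1,\dots,v_N$. Consider linear losses $f_t(x)=\langle c_t,x\rangle$ with $f_t(x)\in[-1,1]$ for every $x\in\mathcal X$ (possibly chosen adaptively). Running the continuous alternation-aware Hedge algorithm (defined in the context) with $\mu$ the uniform distribution on $\{v_1,\dots,v_N\}$ gives, for every $T\ge1$, $$\max_{u\in\mathcal X}\mathrm{Reg}_{\mathrm{Alt}}^T(u)\le8\log N .$$ In particular, for $\mathcal X=\Delta_d$ and $c_t\in[-1,1]^d$, the algorithm coincides with the (finite) alternation-aware Hedge algorithm (defined in the context), and the bound is $8\log d$.
   Context: In round $t\ge1$ the learner chooses $x_t\in\mathcal X$ using $f_1,\dots,f_{t-1}$; then $f_t$ is chosen (possibly depending on $x_1,\dots,x_t$) and revealed. With $f_0\equiv0$ and $g_t=f_{t-1}+f_t$, the alternating regret to $u\in\mathcal X$ is $\mathrm{Reg}_{\mathrm{Alt}}^T(u)=\sum_{t=1}^T(g_t(x_t)-g_t(u))$. Continuous alternation-aware Hedge with reference Borel probability measure $\mu$ on $\mathcal X$: set $\eta=1/8$, $\beta=1/32$, $L_0\equiv0$. For $t=1,2,\dots$: (1) let $\theta_t$ be the unique maximizer over $\theta\in\mathbb R$ of $\log\int_{\mathcal X}\exp[-\eta L_{t-1}(u)-\beta(f_{t-1}(u)-\theta)^2]\,\mu(\mathrm du)$; (2) set $\xi_t(u)=f_{t-1}(u)-\theta_t$ and let $P_t$ be the probability measure with $P_t(\mathrm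 du)\propto\exp[-\eta L_{t-1}(u)-\beta\xi_t(u)^2]\,\mu(\mathrm du)$; (3) set $Q_t(\mathrm du)=(1-\xi_t(u)/2)P_t(\mathrm du)$, which is a probability measure; (4) play $x_t=\int_{\mathcal X}u\,Q_t(\mathrm du)$; (5) observe $f_t$ and set $L_t=L_{t-1}+f_{t-1}+f_t$. Finite alternation-aware Hedge on $\Delta_d=\{x\in\mathbb R^d:x_i\ge0,\sum_ix_i=1\}$: $\eta=1/8$, $\beta=1/32$, $c_0=0$, $L_0=0\in\mathbb R^d$; in round $t$, $\theta_t$ is the unique maximizer of $\log\sum_{i}\exp[-\eta L_{t-1,i}-\beta(c_{t-1,i}-\theta)^2]$, $p_{t,i}\propto\exp[-\eta L_{t-1,i}-\beta(c_{t-1,i}-\theta_t)^2]$, play $x_{t,i}=p_{t,i}(1-(c_{t-1,i}-\theta_t)/2)$, then $L_t=L_{t-1}+c_{t-1}+c_t$. *)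

theory Defs
  imports "HOL-Probability.Probability"
begin

section \<open>Alternating regret\<close>

text \<open>Losses are indexed from round 0, where the loss vanishes identically by convention
  (users assume this explicitly); rounds of play are indexed from 1.\<close>

definition alt_regret :: "(nat \<Rightarrow> 'a \<Rightarrow> real) \<Rightarrow> (nat \<Rightarrow> 'a) \<Rightarrow> nat \<Rightarrow> 'a \<Rightarrow> real" where
  "alt_regret f x T u =
     (let g = (\<lambda>t y. f (t - 1) y + f t y) in \<Sum>t=1..T. g t (x t) - g t u)"

section \<open>Continuous alternation-aware Hedge\<close>

abbreviation hedge_eta :: real where "hedge_eta \<equiv> 1 / 8"
abbreviation hedge_beta :: real where "hedge_beta \<equiv> 1 / 32"

primrec cum_loss :: "(nat \<Rightarrow> 'a \<Rightarrow> real) \<Rightarrow> nat \<Rightarrow> 'a \<Rightarrow> real" where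
  "cum_loss f 0 u = 0"
| "cum_loss f (Suc t) u = cum_loss f t u + f t u + f (Suc t) u"

text \<open>The round-\<open>t\<close> quantities below only use the losses of rounds before \<open>t\<close>, and are meant for
  \<open>t \<ge> 1\<close>.  The description operator in \<open>hedge_theta\<close> is meaningful exactly when the maximizer
  exists and is unique; this is not built into the definition.\<close>

definition hedge_weight :: "(nat \<Rightarrow> 'a \<Rightarrow> real) \<Rightarrow> nat \<Rightarrow> real \<Rightarrow> 'a \<Rightarrow> real" where
  "hedge_weight f t \<theta> u =
     exp (- hedge_eta * cum_loss f (t - 1) u - hedge_beta * (f (t - 1) u - \<theta>)\<^sup>2)"

definition hedge_theta :: "'a measure \<Rightarrow> (nat \<Rightarrow> 'a \<Rightarrow> real) \<Rightarrow> nat \<Rightarrow> real" where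
  "hedge_theta \<mu> f t =
     (THE \<theta>. is_arg_max (\<lambda>\<theta>. ln (\<integral>u. hedge_weight f t \<theta> u \<partial>\<mu>)) (\<lambda>_. True) \<theta>)"

definition hedge_xi :: "'a measure \<Rightarrow> (nat \<Rightarrow> 'a \<Rightarrow> real) \<Rightarrow> nat \<Rightarrow> 'a \<Rightarrow> real" where
  "hedge_xi \<mu> f t u = f (t - 1) u - hedge_theta \<mu> f t"

definition hedge_P :: "'a measure \<Rightarrow> (nat \<Rightarrow> 'a \<Rightarrow> real) \<Rightarrow> nat \<Rightarrow> 'a measure" where
  "hedge_P \<mu> f t =
     (let w = hedge_weight f t (hedge_theta \<mu> f t)
      in density \<mu> (\<lambda>u. ennreal (w u / (\<integral>y. w y \<partial>\<mu>))))"

definition hedge_Q :: "'a measure \<Rightarrow> (nat \<Rightarrow> 'a \<Rightarrow> real) \<Rightarrow> nat \<Rightarrow> 'a measure" where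
  "hedge_Q \<mu> f t = density (hedge_P \<mu> f t) (\<lambda>u. ennreal (1 - hedge_xi \<mu> f t u / 2))"

definition hedge_play ::
    "'a::euclidean_space measure \<Rightarrow> (nat \<Rightarrow> 'a \<Rightarrow> real) \<Rightarrow> nat \<Rightarrow> 'a" where
  "hedge_play \<mu> f t = (\<integral>u. u \<partial>(hedge_Q \<mu> f t))"

text \<open>The uniform distribution on a finite nonempty \<open>V \<subseteq> X\<close>, as a Borel measure on \<open>X\<close>.\<close>

definition uniform_borel_on :: "'a::euclidean_space set \<Rightarrow> 'a set \<Rightarrow> 'a measure" where
  "uniform_borel_on X V = distr (uniform_count_measure V) (restrict_space borel X) (\<lambda>v. v)"

section \<open>Finite alternation-aware Hedge\<close>

definition prob_simplex :: "(real ^ 'd) set" where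
  "prob_simplex = {x. (\<forall>i. 0 \<le> x $ i) \<and> (\<Sum>i\<in>UNIV. x $ i) = 1}"

primrec fin_cum_loss :: "(nat \<Rightarrow> real ^ 'd) \<Rightarrow> nat \<Rightarrow> real ^ 'd" where
  "fin_cum_loss c 0 = 0"
| "fin_cum_loss c (Suc t) = fin_cum_loss c t + c t + c (Suc t)"

definition fin_hedge_weight :: "(nat \<Rightarrow> real ^ 'd) \<Rightarrow> nat \<Rightarrow> real \<Rightarrow> 'd \<Rightarrow> real" where
  "fin_hedge_weight c t \<theta> i =
     exp (- hedge_eta * fin_cum_loss c (t - 1) $ i - hedge_beta * (c (t - 1) $ i - \<theta>)\<^sup>2)"

definition fin_hedge_theta :: "(nat \<Rightarrow> real ^ 'd) \<Rightarrow> nat \<Rightarrow> real" where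
  "fin_hedge_theta c t =
     (THE \<theta>. is_arg_max (\<lambda>\<theta>. ln (\<Sum>i\<in>UNIV. fin_hedge_weight c t \<theta> i)) (\<lambda>_. True) \<theta>)"

definition fin_hedge_p :: "(nat \<Rightarrow> real ^ 'd) \<Rightarrow> nat \<Rightarrow> 'd \<Rightarrow> real" where
  "fin_hedge_p c t i =
     (let w = fin_hedge_weight c t (fin_hedge_theta c t) in w i / (\<Sum>j\<in>UNIV. w j))"

definition fin_hedge_play :: "(nat \<Rightarrow> real ^ 'd) \<Rightarrow> nat \<Rightarrow> real ^ 'd" where
  "fin_hedge_play c t =
     (\<chi> i. fin_hedge_p c t i * (1 - (c (t - 1) $ i - fin_hedge_theta c t) / 2))"

end

theory Submission imports Defs begin

text \<open>
  The potential is the maximal partition sum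
  \<open>Z\<^sub>t = max\<^sub>\<theta> \<Sum>\<^sub>v exp (- L\<^sub>t\<^sub>-\<^sub>1(v) / 8 - (f\<^sub>t\<^sub>-\<^sub>1(v) - \<theta>)\<^sup>2 / 32)\<close>.
  Write \<open>\<xi>\<close> and \<open>y\<close> for \<open>f\<^sub>t\<^sub>-\<^sub>1\<close> and \<open>f\<^sub>t\<close> centred at the maximizers of rounds \<open>t\<close> and \<open>t + 1\<close>; both lie
  in \<open>[-2, 2]\<close>.  The pointwise inequality
  \<open>exp ((\<xi>\<^sup>2 - 4 \<xi> - y\<^sup>2 - 4 y) / 32) \<le> 1 - (1 - \<xi> / 2) (\<xi> + y) / 8\<close>, averaged over \<open>P\<^sub>t\<close>, bounds
  \<open>Z\<^sub>t\<^sub>+\<^sub>1\<close> by \<open>Z\<^sub>t exp (- g\<^sub>t(x\<^sub>t) / 8)\<close>; the factor \<open>1 - \<xi> / 2\<close> is exactly the density of \<open>Q\<^sub>t\<close>.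
  Since \<open>Z\<^sub>1 \<le> N\<close>, and \<open>Z\<^sub>T\<^sub>+\<^sub>1 \<ge> exp (- L\<^sub>T(v) / 8)\<close> by taking \<open>\<theta> = f\<^sub>T(v)\<close>, telescoping gives the regret
  bound at each vertex, and the regret is affine in the comparator.
\<close>

section \<open>Scalar exponential inequalities\<close>

text \<open>With \<open>v = - w\<close>, the product of \<open>1 - v + v\<^sup>2 / 2\<close> and
  \<open>1 + v + v\<^sup>2 / 2\<close> is \<open>1 + v ^ 4 / 4\<close>, hence at least 1, and the
  second factor is at most \<open>exp v\<close>.\<close>

lemma exp_le_quadratic_of_nonpos:
  fixes w :: real
  assumes "w \<le> 0"
  shows "exp w \<le> 1 + w + w\<^sup>2 / 2"
proof -
  define v where "v = - w"
  have v: "0 \<le> v" using assms by (simp add: v_def)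
  have low: "1 + v + v\<^sup>2 / 2 \<le> exp v"
    using exp_lower_Taylor_quadratic[OF v] by simp
  have pos: "0 \<le> 1 - v + v\<^sup>2 / 2"
  proof -
    have "1 - v + v\<^sup>2 / 2 = ((1 - v)\<^sup>2 + 1) / 2" by (simp add: power2_eq_square field_simps)
    also have "0 \<le> \<dots>" by simp
    finally show ?thesis .
  qed
  have "1 \<le> 1 + (v\<^sup>2)\<^sup>2 / 4" by simp
  also have "\<dots> = (1 - v + v\<^sup>2 / 2) * (1 + v + v\<^sup>2 / 2)"
    by (simp add: power2_eq_square field_simps)
  also have "\<dots> \<le> (1 - v + v\<^sup>2 / 2) * exp v"
    by (rule mult_left_mono[OF low pos])
  finally have "exp (- v) \<le> 1 - v + v\<^sup>2 / 2"
    by (simp add: exp_minus field_simps)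
  thus ?thesis by (simp add: v_def)
qed

text \<open>The Lagrange remainder is \<open>exp t / 6 * w ^ 3\<close>, and \<open>exp t\<close>
  stays below 2 when \<open>\<bar>t\<bar>\<close> is at most 1/2.\<close>

lemma exp_le_cubic:
  fixes w :: real
  assumes "0 \<le> w" "w \<le> 1 / 2"
  shows "exp w \<le> 1 + w + w\<^sup>2 / 2 + w ^ 3 / 3"
proof -
  obtain t where t: "\<bar>t\<bar> \<le> \<bar>w\<bar>"
    and e: "exp w = (\<Sum>m<3. w ^ m / fact m) + exp t / fact 3 * w ^ 3"
    using Maclaurin_exp_le[of w 3] by blast
  have "exp t \<le> exp (1 / 2)" using t assms by simp
  also have "\<dots> \<le> 2" using exp_bound[of "1 / 2"] by (simp add: power2_eq_square)
  finally have "exp t / 6 * w ^ 3 \<le> 2 / 6 * w ^ 3"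
    using assms by (intro mult_right_mono) auto
  thus ?thesis using e by (simp add: eval_nat_numeral)
qed

text \<open>With \<open>s = \<xi> + y\<close> and \<open>d = 4 - \<xi> + y\<close> the exponent is \<open>- s d / 32\<close>, and the slack over the
  linear part of the exponential is \<open>s\<^sup>2 / 32\<close>; the crucial constraint is \<open>d \<le> 8 - \<bar>s\<bar>\<close>.\<close>

lemma exp_le_one_minus_tilted:
  fixes \<xi> y :: real
  assumes "\<bar>\<xi>\<bar> \<le> 2" "\<bar>y\<bar> \<le> 2"
  shows "exp ((\<xi>\<^sup>2 - 4 * \<xi> - y\<^sup>2 - 4 * y) / 32) \<le> 1 - (1 - \<xi> / 2) * (\<xi> + y) / 8"
proof -
  define s where "s = \<xi> + y"
  define d where "d = 4 - \<xi> + y"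
  define w where "w = - s * d / 32"
  have d0: "0 \<le> d" and d8: "d \<le> 8 - \<bar>s\<bar>" and s4: "\<bar>s\<bar> \<le> 4"
    using assms by (auto simp: s_def d_def abs_if split: if_splits)
  have w_eq: "w = (\<xi>\<^sup>2 - 4 * \<xi> - y\<^sup>2 - 4 * y) / 32"
    by (simp add: w_def s_def d_def power2_eq_square algebra_simps)
  have target: "1 - (1 - \<xi> / 2) * (\<xi> + y) / 8 = 1 + w + s\<^sup>2 / 32"
    unfolding w_eq s_def by (simp add: power2_eq_square field_simps)
  have w2: "w\<^sup>2 = s\<^sup>2 * d\<^sup>2 / 1024"
    by (simp add: w_def power2_eq_square)
  have "exp w \<le> 1 + w + s\<^sup>2 / 32"
  proof (cases "w \<le> 0")
    \<comment> \<open>Here \<open>d\<close> at most 8 suffices: it turns the second-order term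
      \<open>w\<^sup>2 / 2\<close> into at most \<open>s\<^sup>2 / 32\<close>, exactly the
      slack.\<close>
    case True
    have "d\<^sup>2 \<le> 8\<^sup>2" using d0 d8 by (intro power_mono) auto
    hence "s\<^sup>2 * d\<^sup>2 \<le> s\<^sup>2 * 64" by (intro mult_left_mono) auto
    thus ?thesis using exp_le_quadratic_of_nonpos[OF True] w2 by simp
  next
    case False
    \<comment> \<open>Since \<open>d\<close> is nonnegative, a positive exponent forces
      \<open>s\<close> to be negative.\<close>
    define r where "r = - s"
    have r: "0 \<le> r" "r \<le> 4"
      using False d0 s4 by (auto simp: r_def w_def mult_less_0_iff not_le)
    have dr: "d \<le> 8 - r" using d8 by (simp add: r_def)
    have wr: "w = r * d / 32" by (simp add: w_def r_def)
    have rd: "r * d \<le> r * (8 - r)" using dr r by (intro mult_left_mono) auto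
    have "r * (8 - r) \<le> 16"
      using zero_le_power2[of "r - 4"] by (simp add: power2_eq_square algebra_simps)
    hence whalf: "w \<le> 1 / 2" using rd unfolding wr by linarith
    have "r * (8 - r) \<le> r * 8" using r by (intro mult_left_mono) auto
    hence w4: "w \<le> r / 4" using rd unfolding wr by linarith
    \<comment> \<open>The second- and third-order terms sum to \<open>s\<^sup>2 / 2048\<close> times
      this quantity, so the slack \<open>s\<^sup>2 / 32\<close> covers them once it is at most 64.
      The gap between \<open>d\<close> and 8 pays for the cubic term.\<close>
    have "d\<^sup>2 * (1 + 2 * w / 3) \<le> (8 - r)\<^sup>2 * (1 + r / 6)"
      using dr d0 w4 False by (intro mult_mono power_mono) auto
    also have "\<dots> = 64 - r * (32 + 10 * r - r * r) / 6"
      by (simp add: power2_eq_square field_simps)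
    also have "\<dots> \<le> 64"
    proof -
      have "r * r \<le> 4 * r" using r by (intro mult_right_mono) auto
      hence "0 \<le> 32 + 10 * r - r * r" using r by linarith
      thus ?thesis using r by simp
    qed
    finally have "s\<^sup>2 * (d\<^sup>2 * (1 + 2 * w / 3)) \<le> s\<^sup>2 * 64"
      by (intro mult_left_mono) auto
    moreover have "w\<^sup>2 / 2 + w ^ 3 / 3 = s\<^sup>2 * (d\<^sup>2 * (1 + 2 * w / 3)) / 2048"
    proof -
      have "w\<^sup>2 / 2 + w ^ 3 / 3 = w\<^sup>2 * (1 + 2 * w / 3) / 2"
        by (simp add: power2_eq_square power3_eq_cube field_simps)
      thus ?thesis by (simp add: w2)
    qed
    ultimately show ?thesis
      using exp_le_cubic[of w] False whalf by simp
  qed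
  thus ?thesis by (simp only: target w_eq[symmetric])
qed

section \<open>Gaussian mixtures and their maximizer\<close>

text \<open>The derivative has the sign of \<open>1 - z\<^sup>2 / 16\<close>, positive on [-2, 2].
  This range contains every difference of two points of [-1, 1].\<close>

lemma gaussian_moment_strict_mono:
  fixes x y :: real
  assumes "-2 \<le> x" "x < y" "y \<le> 2"
  shows "x * exp (- (x\<^sup>2) / 32) < y * exp (- (y\<^sup>2) / 32)"
proof (rule DERIV_pos_imp_increasing[OF \<open>x < y\<close>])
  fix z :: real assume "x \<le> z" "z \<le> y"
  hence z: "\<bar>z\<bar> \<le> 2" using assms by auto
  have "z\<^sup>2 \<le> 4" using z abs_le_square_iff[of z 2] by simp
  hence "0 < exp (- (z\<^sup>2) / 32) * (1 - z\<^sup>2 / 16)" by simp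
  moreover have "((\<lambda>z. z * exp (- (z\<^sup>2) / 32)) has_real_derivative
      exp (- (z\<^sup>2) / 32) * (1 - z\<^sup>2 / 16)) (at z)"
    by (auto intro!: derivative_eq_intros simp: field_simps power2_eq_square)
  ultimately show "\<exists>D. ((\<lambda>z. z * exp (- (z\<^sup>2) / 32)) has_real_derivative D) (at z) \<and> 0 < D"
    by blast
qed

text \<open>The partition sum as a function of \<theta> alone: \<open>A\<close> will carry the
  exponentiated cumulative losses and \<open>a\<close> the latest losses.\<close>

definition gauss_mix :: "'v set \<Rightarrow> ('v \<Rightarrow> real) \<Rightarrow> ('v \<Rightarrow> real) \<Rightarrow> real \<Rightarrow> real" where
  "gauss_mix V A a \<theta> = (\<Sum>v\<in>V. A v * exp (- ((a v - \<theta>)\<^sup>2) / 32))"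

context
  fixes V :: "'v set" and A a :: "'v \<Rightarrow> real"
  assumes fin: "finite V" and ne: "V \<noteq> {}"
    and A_pos: "\<And>v. v \<in> V \<Longrightarrow> 0 < A v"
    and a_bound: "\<And>v. v \<in> V \<Longrightarrow> \<bar>a v\<bar> \<le> 1"
begin

abbreviation G :: "real \<Rightarrow> real" where "G \<equiv> gauss_mix V A a"

lemma gauss_mix_pos: "0 < G \<theta>"
  unfolding gauss_mix_def using fin ne A_pos by (intro sum_pos) auto

text \<open>Clamping \<theta> to the nearer endpoint of [-1, 1] brings it strictly closer to every
  \<open>a v\<close>, so each summand grows.\<close>

lemma gauss_mix_outside:
  assumes "1 < \<bar>\<theta>\<bar>"
  shows "G \<theta> < G (sgn \<theta>)"
  unfolding gauss_mix_def
proof (rule sum_strict_mono[OF fin ne])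
  fix v assume v: "v \<in> V"
  have "\<bar>a v - sgn \<theta>\<bar> < \<bar>a v - \<theta>\<bar>"
    using a_bound[OF v] assms by (cases "\<theta> > 0") (auto simp: sgn_if)
  hence "(a v - sgn \<theta>)\<^sup>2 < (a v - \<theta>)\<^sup>2"
    by (metis abs_ge_zero power2_abs power_strict_mono zero_less_numeral)
  thus "A v * exp (- ((a v - \<theta>)\<^sup>2) / 32) < A v * exp (- ((a v - sgn \<theta>)\<^sup>2) / 32)"
    using A_pos[OF v] by simp
qed

lemma gauss_mix_max_bound:
  assumes "\<And>y. G y \<le> G \<theta>"
  shows "\<bar>\<theta>\<bar> \<le> 1"
  using gauss_mix_outside[of \<theta>] assms[of "sgn \<theta>"] by linarith

lemma gauss_mix_max_exists: "\<exists>\<theta>. \<forall>y. G y \<le> G \<theta>"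
proof -
  have "continuous_on {-1..1} G"
    unfolding gauss_mix_def by (intro continuous_intros) auto
  then obtain \<theta> where \<theta>: "\<And>y. y \<in> {-1..1} \<Longrightarrow> G y \<le> G \<theta>"
    using continuous_attains_sup[of "{-1..1::real}" G] by force
  have "G y \<le> G \<theta>" for y
  proof (cases "\<bar>y\<bar> \<le> 1")
    case True
    thus ?thesis by (intro \<theta>) auto
  next
    case False
    hence "G y < G (sgn y)" by (intro gauss_mix_outside) auto
    also have "\<dots> \<le> G \<theta>" by (intro \<theta>) (auto simp: sgn_if)
    finally show ?thesis by simp
  qed
  thus ?thesis by blast
qed

text \<open>First-order condition, up to the factor 1/16. It later says that \<xi> has mean zero
  under \<open>P\<^sub>t\<close>.\<close>

lemma gauss_mix_max_stationary:
  assumes "\<And>y. G y \<le> G \<theta>"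
  shows "(\<Sum>v\<in>V. A v * ((a v - \<theta>) * exp (- ((a v - \<theta>)\<^sup>2) / 32))) = 0"
proof -
  have "(G has_real_derivative
      (\<Sum>v\<in>V. A v * ((a v - \<theta>) * exp (- ((a v - \<theta>)\<^sup>2) / 32)) / 16)) (at \<theta>)"
    unfolding gauss_mix_def
    by (rule DERIV_sum) (auto intro!: derivative_eq_intros simp: field_simps power2_eq_square)
  hence "(\<Sum>v\<in>V. A v * ((a v - \<theta>) * exp (- ((a v - \<theta>)\<^sup>2) / 32)) / 16) = 0"
    by (rule DERIV_local_max[of _ _ _ 1]) (use assms in auto)
  thus ?thesis by (simp add: sum_divide_distrib[symmetric])
qed

text \<open>All maximizers lie in [-1, 1], where the derivative of \<open>G\<close> is strictly
  decreasing and so vanishes at most once.\<close>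

lemma gauss_mix_max_unique:
  assumes "\<And>y. G y \<le> G \<theta>" "\<And>y. G y \<le> G \<theta>'"
  shows "\<theta> = \<theta>'"
proof -
  have no_less: False
    if "p < q" and p: "\<And>y. G y \<le> G p" and q: "\<And>y. G y \<le> G q"
    for p q
  proof -
    have "(\<Sum>v\<in>V. A v * ((a v - q) * exp (- ((a v - q)\<^sup>2) / 32)))
        < (\<Sum>v\<in>V. A v * ((a v - p) * exp (- ((a v - p)\<^sup>2) / 32)))"
    proof (rule sum_strict_mono[OF fin ne])
      fix v assume v: "v \<in> V"
      have "(a v - q) * exp (- ((a v - q)\<^sup>2) / 32) < (a v - p) * exp (- ((a v - p)\<^sup>2) / 32)"
        using a_bound[OF v] gauss_mix_max_bound[OF p] gauss_mix_max_bound[OF q] \<open>p < q\<close>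
        by (intro gaussian_moment_strict_mono) auto
      thus "A v * ((a v - q) * exp (- ((a v - q)\<^sup>2) / 32))
          < A v * ((a v - p) * exp (- ((a v - p)\<^sup>2) / 32))"
        using A_pos[OF v] by simp
    qed
    thus False unfolding gauss_mix_max_stationary[OF p] gauss_mix_max_stationary[OF q] by simp
  qed
  show ?thesis
    using no_less[of \<theta> \<theta>'] no_less[of \<theta>' \<theta>] assms by (cases \<theta> \<theta>' rule: linorder_cases) auto
qed

text \<open>The scale \<open>k\<close> is the number of vertices for the uniform measure and 1 for
  the finite algorithm; neither it nor the logarithm moves the maximizers.\<close>

lemma is_arg_max_ln_gauss_mix:
  assumes "0 < k"
  shows "is_arg_max (\<lambda>\<theta>. ln (G \<theta> / k)) (\<lambda>_. True) \<theta> \<longleftrightarrow> (\<forall>y. G y \<le> G \<theta>)"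
  using assms gauss_mix_pos by (simp add: is_arg_max_linorder divide_right_mono divide_le_cancel)

lemma ex1_arg_max_ln_gauss_mix:
  assumes "0 < k"
  shows "\<exists>!\<theta>. is_arg_max (\<lambda>\<theta>. ln (G \<theta> / k)) (\<lambda>_. True) \<theta>"
  unfolding is_arg_max_ln_gauss_mix[OF assms]
  using gauss_mix_max_exists gauss_mix_max_unique by blast

end

section \<open>Integration against the uniform measure on a finite set\<close>

lemma integral_uniform_borel_on:
  fixes h :: "'a::euclidean_space \<Rightarrow> 'b::{banach, second_countable_topology}"
  assumes "finite V" "V \<subseteq> X" "h \<in> borel_measurable borel"
  shows "integral\<^sup>L (uniform_borel_on X V) h = (\<Sum>v\<in>V. h v) /\<^sub>R card V"
proof -
  have "integral\<^sup>L (uniform_borel_on X V) h = integral\<^sup>L (uniform_count_measure V) h"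
    unfolding uniform_borel_on_def
    using assms
    by (subst integral_distr)
      (auto simp: measurable_def space_restrict_space sets_restrict_space space_uniform_count_measure sets_uniform_count_measure
        intro!: measurable_restrict_space1)
  also have "\<dots> = (\<Sum>v\<in>V. h v) /\<^sub>R card V"
    unfolding uniform_count_measure_def
    using assms by (subst lebesgue_integral_point_measure_finite) (auto simp: scaleR_sum_right inverse_eq_divide)
  finally show ?thesis .
qed

text \<open>As \<open>P\<close> may be nonmeasurable, the argument goes through membership in
  \<open>V\<close>, which is finite and hence Borel.\<close>

lemma AE_uniform_borel_on:
  assumes "finite V" "V \<subseteq> X" "\<And>v. v \<in> V \<Longrightarrow> P v"
  shows "AE u in uniform_borel_on X V. P u"
proof -
  have m: "(\<lambda>v. v) \<in> measurable (uniform_count_measure V) (restrict_space borel X)"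
    using assms(2) by (auto simp: measurable_def space_restrict_space
        space_uniform_count_measure sets_uniform_count_measure)
  have "V \<in> sets borel" using assms(1) by (simp add: borel_closed finite_imp_closed)
  hence "{u \<in> space (restrict_space borel X). u \<in> V} \<in> sets (restrict_space borel X)"
    using assms(2) by (auto simp: space_restrict_space sets_restrict_space intro!: image_eqI[of _ _ V])
  hence "AE u in uniform_borel_on X V. u \<in> V"
    unfolding uniform_borel_on_def
    by (subst AE_distr_iff[OF m]) (auto intro!: AE_I2 simp: space_uniform_count_measure)
  thus ?thesis by (rule AE_mp) (auto intro!: AE_I2 assms(3))
qed

lemma measurable_uniform_borel_on:
  assumes "h \<in> borel_measurable borel"
  shows "h \<in> borel_measurable (uniform_borel_on X V)"
  using measurable_restrict_space1[OF assms] unfolding uniform_borel_on_def by simp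

section \<open>The potential argument on a finite vertex set\<close>

text \<open>Common ground of the polytope and the simplex. Index 0 is included in the bound; there
  it will follow from \<open>c 0 = 0\<close>.\<close>

locale vertex_hedge =
  fixes X V :: "'a::euclidean_space set" and c :: "nat \<Rightarrow> 'a"
  assumes finite_V: "finite V" and V_ne: "V \<noteq> {}" and V_sub: "V \<subseteq> X"
    and bounded: "\<And>t v. v \<in> V \<Longrightarrow> \<bar>c t \<bullet> v\<bar> \<le> 1"
begin

abbreviation loss :: "nat \<Rightarrow> 'a \<Rightarrow> real" where "loss \<equiv> \<lambda>s u. c s \<bullet> u"
abbreviation \<mu> :: "'a measure" where "\<mu> \<equiv> uniform_borel_on X V"
abbreviation \<theta> :: "nat \<Rightarrow> real" where "\<theta> \<equiv> hedge_theta \<mu> loss"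
abbreviation \<xi> :: "nat \<Rightarrow> 'a \<Rightarrow> real" where "\<xi> \<equiv> hedge_xi \<mu> loss"

definition partition_sum :: "nat \<Rightarrow> real \<Rightarrow> real" where
  "partition_sum t y = (\<Sum>v\<in>V. hedge_weight loss t y v)"

lemma partition_sum_eq_gauss_mix:
  "partition_sum t = gauss_mix V (\<lambda>v. exp (- cum_loss loss (t - 1) v / 8)) (\<lambda>v. c (t - 1) \<bullet> v)"
  by (simp add: fun_eq_iff partition_sum_def gauss_mix_def hedge_weight_def flip: exp_add)

lemma cum_loss_measurable: "cum_loss loss t \<in> borel_measurable borel"
proof (induction t)
  case 0
  have "cum_loss loss 0 = (\<lambda>_. 0)" by (simp add: fun_eq_iff)
  thus ?case by simp
next
  case (Suc t)
  note [measurable] = Suc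
  have "cum_loss loss (Suc t) = (\<lambda>u. cum_loss loss t u + c t \<bullet> u + c (Suc t) \<bullet> u)"
    by (simp add: fun_eq_iff)
  thus ?case by simp
qed

lemma hedge_weight_measurable: "hedge_weight loss t y \<in> borel_measurable borel"
proof -
  note [measurable] = cum_loss_measurable
  have "hedge_weight loss t y =
      (\<lambda>u. exp (- hedge_eta * cum_loss loss (t - 1) u - hedge_beta * (c (t - 1) \<bullet> u - y)\<^sup>2))"
    by (simp add: fun_eq_iff hedge_weight_def)
  thus ?thesis by simp
qed

lemma integral_hedge_weight: "(\<integral>u. hedge_weight loss t y u \<partial>\<mu>) = partition_sum t y / card V"
  using integral_uniform_borel_on[OF finite_V V_sub hedge_weight_measurable[of t y]]
  by (simp add: partition_sum_def divide_inverse mult.commute)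

lemma card_V_pos: "0 < real (card V)"
  using finite_V V_ne by (simp add: card_gt_0_iff)

lemma partition_sum_pos: "0 < partition_sum t y"
  unfolding partition_sum_eq_gauss_mix using finite_V V_ne bounded by (intro gauss_mix_pos) auto

text \<open>Existence and uniqueness of the maximizer give meaning to the description operator in
  \<open>hedge_theta\<close>.\<close>

lemma theta_is_max: "partition_sum t y \<le> partition_sum t (\<theta> t)"
proof -
  let ?A = "\<lambda>v. exp (- cum_loss loss (t - 1) v / 8)" and ?a = "\<lambda>v. c (t - 1) \<bullet> v"
  have "is_arg_max (\<lambda>\<theta>. ln (gauss_mix V ?A ?a \<theta> / card V)) (\<lambda>_. True) (\<theta> t)"
    unfolding hedge_theta_def integral_hedge_weight partition_sum_eq_gauss_mix
    by (rule theI'[OF ex1_arg_max_ln_gauss_mix]) (use finite_V V_ne bounded card_V_pos in auto)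
  hence "\<forall>y. gauss_mix V ?A ?a y \<le> gauss_mix V ?A ?a (\<theta> t)"
    by (subst (asm) is_arg_max_ln_gauss_mix) (use finite_V V_ne bounded card_V_pos in auto)
  thus ?thesis by (simp add: partition_sum_eq_gauss_mix)
qed

lemma theta_bound: "\<bar>\<theta> t\<bar> \<le> 1"
  by (rule gauss_mix_max_bound[OF finite_V V_ne _ _ theta_is_max[of t, unfolded partition_sum_eq_gauss_mix]])
    (simp_all add: bounded)

lemma theta_stationary: "(\<Sum>v\<in>V. hedge_weight loss t (\<theta> t) v * \<xi> t v) = 0"
proof -
  let ?A = "\<lambda>v. exp (- cum_loss loss (t - 1) v / 8)" and ?a = "\<lambda>v. c (t - 1) \<bullet> v"
  have "(\<Sum>v\<in>V. ?A v * ((?a v - \<theta> t) * exp (- ((?a v - \<theta> t)\<^sup>2) / 32))) = 0"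
    by (rule gauss_mix_max_stationary[OF finite_V V_ne _ _
          theta_is_max[of t, unfolded partition_sum_eq_gauss_mix]])
      (simp_all add: bounded)
  moreover have "?A v * ((?a v - \<theta> t) * exp (- ((?a v - \<theta> t)\<^sup>2) / 32))
      = hedge_weight loss t (\<theta> t) v * \<xi> t v" for v
  proof -
    have "hedge_weight loss t (\<theta> t) v = ?A v * exp (- ((?a v - \<theta> t)\<^sup>2) / 32)"
      by (simp add: hedge_weight_def flip: exp_add)
    thus ?thesis by (simp add: hedge_xi_def)
  qed
  ultimately show ?thesis by simp
qed

lemma xi_bound: "v \<in> V \<Longrightarrow> \<bar>\<xi> t v\<bar> \<le> 2"
  using bounded[of v "t - 1"] theta_bound[of t] by (auto simp: hedge_xi_def)

definition prob_weight :: "nat \<Rightarrow> 'a \<Rightarrow> real" where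
  "prob_weight t v = hedge_weight loss t (\<theta> t) v / partition_sum t (\<theta> t)"

lemma prob_weight_sum: "(\<Sum>v\<in>V. prob_weight t v) = 1"
  using partition_sum_pos[of t "\<theta> t"]
  by (simp add: prob_weight_def partition_sum_def flip: sum_divide_distrib)

text \<open>This centring gives \<open>Q\<^sub>t\<close> total mass 1, so that adding a constant to
  a loss shifts its \<open>Q\<^sub>t\<close>-average by the same constant.\<close>

lemma prob_weight_xi: "(\<Sum>v\<in>V. prob_weight t v * \<xi> t v) = 0"
proof -
  have "(\<Sum>v\<in>V. prob_weight t v * \<xi> t v)
      = (\<Sum>v\<in>V. hedge_weight loss t (\<theta> t) v * \<xi> t v) / partition_sum t (\<theta> t)"
    unfolding sum_divide_distrib by (simp add: prob_weight_def)
  thus ?thesis by (simp only: theta_stationary div_0)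
qed

text \<open>The two densities are unfolded in turn; the mass \<open>1 / card V\<close> of a vertex
  cancels against the same factor in the normalizing integral.\<close>

lemma hedge_play_eq:
  "hedge_play \<mu> loss t = (\<Sum>v\<in>V. (prob_weight t v * (1 - \<xi> t v / 2)) *\<^sub>R v)"
proof -
  define w where "w = hedge_weight loss t (\<theta> t)"
  define Z where "Z = partition_sum t (\<theta> t)"
  have Z: "0 < Z" unfolding Z_def by (rule partition_sum_pos)
  have w_nonneg: "0 \<le> w u" for u by (simp add: w_def hedge_weight_def)
  have w_meas [measurable]: "w \<in> borel_measurable borel"
    unfolding w_def by (rule hedge_weight_measurable)
  have xi_meas [measurable]: "\<xi> t \<in> borel_measurable borel"
  proof -
    have "\<xi> t = (\<lambda>u. c (t - 1) \<bullet> u - \<theta> t)" by (simp add: fun_eq_iff hedge_xi_def)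
    thus ?thesis by simp
  qed
  have P: "hedge_P \<mu> loss t = density \<mu> (\<lambda>u. ennreal (w u / (Z / card V)))"
    by (simp add: hedge_P_def Let_def w_def Z_def integral_hedge_weight)
  have "hedge_play \<mu> loss t = (\<integral>u. (1 - \<xi> t u / 2) *\<^sub>R u \<partial>hedge_P \<mu> loss t)"
    unfolding hedge_play_def hedge_Q_def
  proof (rule integral_density)
    \<comment> \<open>The sign of this density is controlled only at the vertices, which carry all
      the mass.\<close>
    have "AE u in \<mu>. 0 \<le> 1 - \<xi> t u / 2"
    proof (rule AE_uniform_borel_on[OF finite_V V_sub])
      fix v assume "v \<in> V"
      thus "0 \<le> 1 - \<xi> t v / 2" using xi_bound[of v t] by (simp add: abs_le_iff)
    qed
    thus "AE u in hedge_P \<mu> loss t. 0 \<le> 1 - \<xi> t u / 2"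
      unfolding P by (subst AE_density) (auto intro!: measurable_uniform_borel_on)
  qed (auto simp: P intro!: measurable_uniform_borel_on)
  also have "\<dots> = (\<integral>u. (w u / (Z / card V)) *\<^sub>R ((1 - \<xi> t u / 2) *\<^sub>R u) \<partial>\<mu>)"
    unfolding P
    by (rule integral_density) (use w_nonneg Z in \<open>auto intro!: measurable_uniform_borel_on AE_I2\<close>)
  also have "\<dots> = (\<Sum>v\<in>V. (w v / (Z / card V)) *\<^sub>R ((1 - \<xi> t v / 2) *\<^sub>R v)) /\<^sub>R card V"
    by (rule integral_uniform_borel_on[OF finite_V V_sub]) simp
  also have "\<dots> = (\<Sum>v\<in>V. (prob_weight t v * (1 - \<xi> t v / 2)) *\<^sub>R v)"
    unfolding scaleR_sum_right scaleR_scaleR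
  proof (intro sum.cong refl)
    fix v
    have "inverse (real (card V)) * (w v / (Z / real (card V)) * (1 - \<xi> t v / 2))
        = prob_weight t v * (1 - \<xi> t v / 2)"
      using card_V_pos by (simp add: prob_weight_def w_def Z_def)
    thus "(inverse (real (card V)) * (w v / (Z / real (card V)) * (1 - \<xi> t v / 2))) *\<^sub>R v
        = (prob_weight t v * (1 - \<xi> t v / 2)) *\<^sub>R v"
      by (rule arg_cong)
  qed
  finally show ?thesis .
qed

lemma partition_sum_step:
  "partition_sum (Suc (Suc s)) (\<theta> (Suc (Suc s)))
    \<le> partition_sum (Suc s) (\<theta> (Suc s))
      * exp (- (loss s (hedge_play \<mu> loss (Suc s)) + loss (Suc s) (hedge_play \<mu> loss (Suc s))) / 8)"
proof -
  define t where "t = Suc s"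
  define Z where "Z = partition_sum t (\<theta> t)"
  define p where "p = prob_weight t"
  define y where "y v = \<xi> (Suc t) v" for v
  define h where "h v = (1 - \<xi> t v / 2) * (\<xi> t v + y v)" for v
  define E where "E = exp (- (\<theta> t + \<theta> (Suc t)) / 8)"
  define x where "x = hedge_play \<mu> loss t"
  have Z: "0 < Z" unfolding Z_def by (rule partition_sum_pos)
  \<comment> \<open>Both losses are written as centred loss plus maximizer; the maximizers leave the
    average because \<open>Q\<^sub>t\<close> has mass 1.\<close>
  have loss_x: "loss s x + loss t x = (\<Sum>v\<in>V. p v * h v) + \<theta> t + \<theta> (Suc t)"
  proof -
    have "loss s x + loss t x = (\<Sum>v\<in>V. p v * (1 - \<xi> t v / 2) * (c s \<bullet> v + c t \<bullet> v))"
      by (simp add: x_def hedge_play_eq p_def inner_sum_right sum.distrib[symmetric] distrib_left)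
    also have "\<dots> = (\<Sum>v\<in>V. p v * h v + (\<theta> t + \<theta> (Suc t)) * (p v - (p v * \<xi> t v) / 2))"
    proof (intro sum.cong refl)
      fix v
      have "c s \<bullet> v = \<xi> t v + \<theta> t" "c t \<bullet> v = y v + \<theta> (Suc t)"
        by (simp_all add: t_def y_def hedge_xi_def)
      thus "p v * (1 - \<xi> t v / 2) * (c s \<bullet> v + c t \<bullet> v)
          = p v * h v + (\<theta> t + \<theta> (Suc t)) * (p v - (p v * \<xi> t v) / 2)"
        unfolding h_def
        by (simp only:) (simp add: algebra_simps add_divide_distrib diff_divide_distrib)
    qed
    also have "\<dots> = (\<Sum>v\<in>V. p v * h v)
        + (\<theta> t + \<theta> (Suc t)) * ((\<Sum>v\<in>V. p v) - (\<Sum>v\<in>V. p v * \<xi> t v) / 2)"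
      by (simp add: sum.distrib sum_subtractf flip: sum_distrib_left sum_divide_distrib)
    also have "\<dots> = (\<Sum>v\<in>V. p v * h v) + \<theta> t + \<theta> (Suc t)"
      by (simp add: p_def prob_weight_sum prob_weight_xi)
    finally show ?thesis .
  qed
  \<comment> \<open>One round adds \<open>- (f\<^sub>t\<^sub>-\<^sub>1 + f\<^sub>t) / 8\<close> to
    the exponent and trades the penalty in \<xi> for the one in \<open>y\<close>. The maximizers do
    not depend on \<open>v\<close> and are collected in \<open>E\<close>.\<close>
  have weight_step: "hedge_weight loss (Suc t) (\<theta> (Suc t)) v
      = Z * p v * exp (((\<xi> t v)\<^sup>2 - 4 * \<xi> t v - (y v)\<^sup>2 - 4 * y v) / 32) * E" for v
  proof -
    have "Z * p v = hedge_weight loss t (\<theta> t) v"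
      using Z by (simp add: p_def prob_weight_def Z_def)
    thus ?thesis
      by (simp add: hedge_weight_def E_def t_def y_def hedge_xi_def power2_eq_square field_simps
          flip: exp_add)
  qed
  have p_nonneg: "0 \<le> p v" for v
    using partition_sum_pos[of t "\<theta> t"] by (simp add: p_def prob_weight_def hedge_weight_def)
  have "partition_sum (Suc t) (\<theta> (Suc t))
      = (\<Sum>v\<in>V. Z * p v * exp (((\<xi> t v)\<^sup>2 - 4 * \<xi> t v - (y v)\<^sup>2 - 4 * y v) / 32) * E)"
    by (simp add: partition_sum_def weight_step)
  also have "\<dots> \<le> (\<Sum>v\<in>V. Z * p v * (1 - h v / 8) * E)"
  proof (intro sum_mono mult_right_mono mult_left_mono)
    fix v assume "v \<in> V"
    thus "exp (((\<xi> t v)\<^sup>2 - 4 * \<xi> t v - (y v)\<^sup>2 - 4 * y v) / 32) \<le> 1 - h v / 8"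
      unfolding h_def y_def by (intro exp_le_one_minus_tilted xi_bound)
  qed (use Z p_nonneg in \<open>auto simp: E_def\<close>)
  also have "\<dots> = Z * E * ((\<Sum>v\<in>V. p v) - (\<Sum>v\<in>V. p v * h v) / 8)"
    unfolding sum_divide_distrib sum_subtractf[symmetric] sum_distrib_left
    by (intro sum.cong refl) (simp add: algebra_simps)
  also have "\<dots> = Z * E * (1 + (- (\<Sum>v\<in>V. p v * h v) / 8))"
    by (simp add: p_def prob_weight_sum)
  \<comment> \<open>The bound \<open>1 + z \<le> exp z\<close> restores an exponential; with
    \<open>E\<close> it becomes the played loss by \<open>loss_x\<close>.\<close>
  also have "\<dots> \<le> Z * E * exp (- (\<Sum>v\<in>V. p v * h v) / 8)"
    using Z by (intro mult_left_mono exp_ge_add_one_self) (auto simp: E_def)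
  also have "\<dots> = Z * exp (- (loss s x + loss t x) / 8)"
    unfolding E_def loss_x by (simp add: field_simps flip: exp_add)
  finally show ?thesis unfolding Z_def x_def t_def .
qed

lemma partition_sum_bound:
  "partition_sum (Suc T) (\<theta> (Suc T))
    \<le> card V * exp (- (\<Sum>t=1..T. loss (t - 1) (hedge_play \<mu> loss t) + loss t (hedge_play \<mu> loss t)) / 8)"
proof (induction T)
  case 0
  \<comment> \<open>The cumulative loss is still zero, so only the nonpositive penalty is left in
    the exponent.\<close>
  have "hedge_weight loss (Suc 0) y v \<le> 1" for y v
    by (simp add: hedge_weight_def)
  hence "partition_sum (Suc 0) (\<theta> (Suc 0)) \<le> card V"
    unfolding partition_sum_def using sum_bounded_above[of V "hedge_weight loss (Suc 0) (\<theta> (Suc 0))" 1] by simp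
  thus ?case by simp
next
  case (Suc T)
  let ?g = "\<lambda>t. loss (t - 1) (hedge_play \<mu> loss t) + loss t (hedge_play \<mu> loss t)"
  have "partition_sum (Suc (Suc T)) (\<theta> (Suc (Suc T)))
      \<le> partition_sum (Suc T) (\<theta> (Suc T)) * exp (- ?g (Suc T) / 8)"
    using partition_sum_step[of T] by simp
  also have "\<dots> \<le> (card V * exp (- (\<Sum>t=1..T. ?g t) / 8)) * exp (- ?g (Suc T) / 8)"
    by (intro mult_right_mono Suc) auto
  also have "\<dots> = card V * exp (- (\<Sum>t=1..Suc T. ?g t) / 8)"
    by (simp add: field_simps flip: exp_add)
  finally show ?case .
qed

lemma cum_loss_eq: "cum_loss f t u = (\<Sum>s=1..t. f (s - 1) u + f s u)"
  by (induction t) auto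

lemma vertex_regret_bound:
  assumes "v \<in> V" and x: "\<And>t. 1 \<le> t \<Longrightarrow> x t = hedge_play \<mu> loss t"
  shows "alt_regret loss x T v \<le> 8 * ln (real (card V))"
proof -
  let ?G = "\<Sum>t=1..T. loss (t - 1) (x t) + loss t (x t)"
  have G: "?G = (\<Sum>t=1..T. loss (t - 1) (hedge_play \<mu> loss t) + loss t (hedge_play \<mu> loss t))"
    by (intro sum.cong) (auto simp: x)
  have "exp (- cum_loss loss T v / 8) = hedge_weight loss (Suc T) (c T \<bullet> v) v"
    by (simp add: hedge_weight_def)
  also have "\<dots> \<le> partition_sum (Suc T) (c T \<bullet> v)"
    unfolding partition_sum_def
    by (rule member_le_sum[OF assms(1) _ finite_V]) (simp add: hedge_weight_def)
  also have "\<dots> \<le> partition_sum (Suc T) (\<theta> (Suc T))" by (rule theta_is_max)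
  also have "\<dots> \<le> card V * exp (- ?G / 8)" unfolding G by (rule partition_sum_bound)
  also have "\<dots> = exp (ln (card V) + (- ?G / 8))"
    using card_V_pos by (simp only: exp_add exp_ln)
  finally have "- cum_loss loss T v / 8 \<le> ln (card V) - ?G / 8" by simp
  thus ?thesis
    by (simp add: alt_regret_def Let_def cum_loss_eq sum_subtractf)
qed

end

section \<open>From vertices to the whole polytope\<close>

lemma alt_regret_linear:
  "alt_regret (\<lambda>s u. c s \<bullet> u) x T u =
    (\<Sum>t=1..T. c (t - 1) \<bullet> x t + c t \<bullet> x t) - (\<Sum>t=1..T. c (t - 1) + c t) \<bullet> u"
  by (simp add: alt_regret_def Let_def sum_subtractf inner_sum_left inner_add_left)

text \<open>The half-space above the least vertex value is convex and contains \<open>V\<close>,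
  hence contains the hull.\<close>

lemma linear_min_on_convex_hull:
  fixes V :: "'a::real_inner set"
  assumes "finite V" "V \<noteq> {}"
  obtains m where "m \<in> V" "\<And>u. u \<in> convex hull V \<Longrightarrow> b \<bullet> m \<le> b \<bullet> u"
proof -
  obtain m where m: "m \<in> V" "\<And>v. v \<in> V \<Longrightarrow> b \<bullet> m \<le> b \<bullet> v"
    using arg_min_if_finite[OF assms, of "\<lambda>v. b \<bullet> v"]
    by (metis not_le)
  have "convex hull V \<subseteq> {u. b \<bullet> m \<le> b \<bullet> u}"
    using m(2) by (intro hull_minimal) (auto simp: convex_halfspace_ge)
  thus ?thesis using m(1) that by blast
qed

text \<open>The maximum over comparators is expressed by a point attaining it: the vertex minimizing
  the summed loss vector, where \<open>vertex_regret_bound\<close> applies.\<close>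

lemma polytope_hedge_regret:
  fixes V :: "'a::euclidean_space set"
  assumes "finite V" "V \<noteq> {}" and c0: "c 0 = 0"
    and bounded: "\<And>t u. 1 \<le> t \<Longrightarrow> u \<in> convex hull V \<Longrightarrow> c t \<bullet> u \<in> {-1..1}"
    and x: "\<And>t. 1 \<le> t \<Longrightarrow> x t = hedge_play (uniform_borel_on (convex hull V) V) (\<lambda>s u. c s \<bullet> u) t"
  shows "\<exists>m\<in>convex hull V.
    (\<forall>u\<in>convex hull V. alt_regret (\<lambda>s u. c s \<bullet> u) x T u \<le> alt_regret (\<lambda>s u. c s \<bullet> u) x T m) \<and>
    alt_regret (\<lambda>s u. c s \<bullet> u) x T m \<le> 8 * ln (real (card V))"
proof -
  interpret vertex_hedge "convex hull V" V c
  proof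
    fix t v assume "v \<in> V"
    thus "\<bar>c t \<bullet> v\<bar> \<le> 1"
      using bounded[of t v] c0 hull_inc[of v V convex] by (cases "t = 0") (auto simp: abs_le_iff)
  qed (use assms(1,2) hull_subset[of V convex] in auto)
  obtain m where m: "m \<in> V"
    "\<And>u. u \<in> convex hull V \<Longrightarrow> (\<Sum>t=1..T. c (t - 1) + c t) \<bullet> m \<le> (\<Sum>t=1..T. c (t - 1) + c t) \<bullet> u"
    using linear_min_on_convex_hull[OF assms(1,2)] by blast
  show ?thesis
    using m vertex_regret_bound[OF m(1) x, of T]
    by (intro bexI[of _ m]) (auto simp: alt_regret_linear hull_inc)
qed

section \<open>The simplex and the finite algorithm\<close>

lemma sum_Basis_vec: "(\<Sum>v\<in>(Basis :: (real ^ 'd) set). h v) = (\<Sum>i\<in>UNIV. h (axis i 1))"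
proof -
  have "(\<Sum>v\<in>(Basis :: (real ^ 'd) set). h v) = sum h ((\<lambda>i. axis i 1) ` UNIV)"
    by (rule arg_cong[of _ _ "sum h"]) (auto simp: Basis_vec_def)
  also have "\<dots> = (\<Sum>i\<in>UNIV. h (axis i 1))"
    by (rule sum.reindex_cong[of "\<lambda>i. axis i 1"]) (simp_all add: inj_def axis_eq_axis)
  finally show ?thesis .
qed

lemma sum_scaleR_axis: "(\<Sum>i\<in>UNIV. w i *\<^sub>R axis i 1) = (\<chi> i. w i)"
  by (simp add: vec_eq_iff axis_def if_distrib cong: if_cong)

lemma prob_simplex_eq_convex_hull: "(prob_simplex :: (real ^ 'd) set) = convex hull Basis"
proof (intro set_eqI iffI)
  fix x :: "real ^ 'd" assume x: "x \<in> prob_simplex"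
  have "(\<Sum>i\<in>UNIV. x $ i *\<^sub>R axis i 1) \<in> convex hull (Basis :: (real ^ 'd) set)"
  proof (rule convex_sum)
    show "(axis i 1 :: real ^ 'd) \<in> convex hull Basis" for i
      by (rule hull_inc) simp
  qed (use x in \<open>simp_all add: prob_simplex_def\<close>)
  thus "x \<in> convex hull Basis" by (simp add: sum_scaleR_axis)
next
  fix x :: "real ^ 'd" assume "x \<in> convex hull Basis"
  then obtain w where w: "\<forall>v\<in>Basis. 0 \<le> w v" "sum w Basis = 1" "(\<Sum>v\<in>Basis. w v *\<^sub>R v) = x"
    by (auto simp: convex_hull_finite)
  have "x = (\<chi> i. w (axis i 1))" using w(3) by (simp add: sum_Basis_vec sum_scaleR_axis)
  thus "x \<in> prob_simplex"
    using w(1,2) by (auto simp: prob_simplex_def sum_Basis_vec)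
qed

text \<open>Linear independence of the basis gives affine independence, so every basis vector is
  extreme in the hull.\<close>

lemma extreme_points_prob_simplex:
  "{v. v extreme_point_of (prob_simplex :: (real ^ 'd) set)} = Basis"
proof -
  have "\<not> affine_dependent (Basis :: (real ^ 'd) set)"
    using affine_dependent_imp_dependent independent_Basis by blast
  thus ?thesis
    by (simp add: prob_simplex_eq_convex_hull extreme_point_of_convex_hull_affine_independent)
qed

lemma cum_loss_axis: "cum_loss (\<lambda>s u. c s \<bullet> u) t (axis i 1) = fin_cum_loss c t $ i"
  by (induction t) (simp_all add: inner_axis)

lemma hedge_weight_axis:
  "hedge_weight (\<lambda>s u. c s \<bullet> u) t y (axis i 1) = fin_hedge_weight c t y i"
  by (simp add: hedge_weight_def fin_hedge_weight_def cum_loss_axis inner_axis)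

lemma hedge_play_simplex:
  fixes c :: "nat \<Rightarrow> real ^ 'd"
  assumes "\<And>t i. \<bar>c t $ i\<bar> \<le> 1"
  shows "hedge_play (uniform_borel_on prob_simplex Basis) (\<lambda>s u. c s \<bullet> u) t = fin_hedge_play c t"
proof -
  interpret vertex_hedge prob_simplex Basis c
  proof
    show "\<bar>c s \<bullet> v\<bar> \<le> 1" if "v \<in> Basis" for s v
      using that assms by (auto simp: Basis_vec_def inner_axis)
  qed (auto simp: prob_simplex_eq_convex_hull hull_inc)
  have sum_eq: "partition_sum t = (\<lambda>y. \<Sum>i\<in>UNIV. fin_hedge_weight c t y i)"
    by (simp add: fun_eq_iff partition_sum_def sum_Basis_vec hedge_weight_axis)
  \<comment> \<open>The two algorithms maximize differently scaled sums. Rewriting both predicates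
    to the same one, free of \<open>k\<close>, makes the two description terms equal.\<close>
  have argmax: "is_arg_max (\<lambda>y. ln (partition_sum t y / k)) (\<lambda>_. True)
      = (\<lambda>z. \<forall>y. partition_sum t y \<le> partition_sum t z)" if "0 < k" for k
    unfolding partition_sum_eq_gauss_mix fun_eq_iff
    by (intro allI is_arg_max_ln_gauss_mix[OF finite_V V_ne _ _ that]) (simp_all add: bounded)
  have argmax_fin: "is_arg_max (\<lambda>y. ln (partition_sum t y)) (\<lambda>_. True)
      = (\<lambda>z. \<forall>y. partition_sum t y \<le> partition_sum t z)"
    using argmax[of 1] by simp
  have "\<theta> t = The (is_arg_max (\<lambda>y. ln (partition_sum t y / card (Basis :: (real ^ 'd) set))) (\<lambda>_. True))"
    unfolding hedge_theta_def integral_hedge_weight ..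
  also have "\<dots> = The (is_arg_max (\<lambda>y. ln (partition_sum t y)) (\<lambda>_. True))"
    unfolding argmax[OF card_V_pos] argmax_fin ..
  also have "\<dots> = fin_hedge_theta c t"
    unfolding fin_hedge_theta_def sum_eq ..
  finally have theta: "\<theta> t = fin_hedge_theta c t" .
  have w: "prob_weight t (axis i 1) = fin_hedge_p c t i" for i
    by (simp add: prob_weight_def fin_hedge_p_def Let_def sum_eq theta hedge_weight_axis)
  show ?thesis
    unfolding hedge_play_eq sum_Basis_vec w fin_hedge_play_def sum_scaleR_axis
    by (simp add: hedge_xi_def theta inner_axis)
qed

theorem corollary2:
  shows
  "(\<forall>(X :: 'a::euclidean_space set) V N (c :: nat \<Rightarrow> 'a) x.
      finite V \<and> V \<noteq> {} \<and> N = card V \<and> X = convex hull V \<and> V = {v. v extreme_point_of X} \<and>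
      c 0 = 0 \<and> (\<forall>t\<ge>1. \<forall>u\<in>X. inner (c t) u \<in> {-1..1}) \<and>
      (\<forall>t\<ge>1. x t = hedge_play (uniform_borel_on X V) (\<lambda>s u. inner (c s) u) t) \<longrightarrow>
      (\<forall>T\<ge>1. \<exists>m\<in>X.
         (\<forall>u\<in>X. alt_regret (\<lambda>s u. inner (c s) u) x T u \<le> alt_regret (\<lambda>s u. inner (c s) u) x T m) \<and>
         alt_regret (\<lambda>s u. inner (c s) u) x T m \<le> 8 * ln (real N)))
   \<and>
   (\<forall>(c :: nat \<Rightarrow> real ^ 'd) x.
      c 0 = 0 \<and> (\<forall>t\<ge>1. \<forall>i. c t $ i \<in> {-1..1}) \<and>
      (\<forall>t\<ge>1. x t = hedge_play
                 (uniform_borel_on prob_simplex {v. v extreme_point_of (prob_simplex :: (real ^ 'd) set)})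
                 (\<lambda>s u. inner (c s) u) t) \<longrightarrow>
      (\<forall>t\<ge>1. x t = fin_hedge_play c t) \<and>
      (\<forall>T\<ge>1. \<exists>m\<in>prob_simplex.
         (\<forall>u\<in>prob_simplex. alt_regret (\<lambda>s u. inner (c s) u) x T u \<le> alt_regret (\<lambda>s u. inner (c s) u) x T m) \<and>
         alt_regret (\<lambda>s u. inner (c s) u) x T m \<le> 8 * ln (real CARD('d))))"
proof (intro conjI allI impI)
  fix X V :: "'a set" and N c and x :: "nat \<Rightarrow> 'a" and T :: nat
  assume "finite V \<and> V \<noteq> {} \<and> N = card V \<and> X = convex hull V \<and> V = {v. v extreme_point_of X} \<and>
      c 0 = 0 \<and> (\<forall>t\<ge>1. \<forall>u\<in>X. inner (c t) u \<in> {-1..1}) \<and>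
      (\<forall>t\<ge>1. x t = hedge_play (uniform_borel_on X V) (\<lambda>s u. inner (c s) u) t)"
  thus "\<exists>m\<in>X.
      (\<forall>u\<in>X. alt_regret (\<lambda>s u. inner (c s) u) x T u \<le> alt_regret (\<lambda>s u. inner (c s) u) x T m) \<and>
      alt_regret (\<lambda>s u. inner (c s) u) x T m \<le> 8 * ln (real N)"
    using polytope_hedge_regret[of V c x T] by blast
next
  fix c :: "nat \<Rightarrow> real ^ 'd" and x
  assume A: "c 0 = 0 \<and> (\<forall>t\<ge>1. \<forall>i. c t $ i \<in> {-1..1}) \<and>
      (\<forall>t\<ge>1. x t = hedge_play
        (uniform_borel_on prob_simplex {v. v extreme_point_of (prob_simplex :: (real ^ 'd) set)})
        (\<lambda>s u. inner (c s) u) t)"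
  have bound: "\<bar>c t $ i\<bar> \<le> 1" for t i
    using A by (cases "t = 0") (auto simp: abs_le_iff dest!: spec[of _ t] spec[of _ i])
  have x: "x t = hedge_play (uniform_borel_on prob_simplex Basis) (\<lambda>s u. c s \<bullet> u) t" if "1 \<le> t" for t
    using A that by (simp add: extreme_points_prob_simplex)
  show "x t = fin_hedge_play c t" if "1 \<le> t" for t
    using x[OF that] hedge_play_simplex[of c t] bound by simp
  \<comment> \<open>Coordinate bounds pass to the simplex, because the entries of \<open>u\<close>
    are nonnegative weights of sum 1.\<close>
  have inner_bound: "c t \<bullet> u \<in> {-1..1}" if u: "u \<in> prob_simplex" for t u
  proof -
    have "\<bar>c t \<bullet> u\<bar> \<le> (\<Sum>i\<in>UNIV. \<bar>c t $ i * u $ i\<bar>)"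
      unfolding inner_vec_def by simp
    also have "\<dots> \<le> (\<Sum>i\<in>UNIV. u $ i)"
      using bound u by (intro sum_mono) (auto simp: abs_mult prob_simplex_def mult_left_le_one_le)
    also have "\<dots> = 1" using u by (simp add: prob_simplex_def)
    finally show ?thesis by (simp add: abs_le_iff)
  qed
  have "c 0 = 0" using A by simp
  show "\<exists>m\<in>prob_simplex.
      (\<forall>u\<in>prob_simplex. alt_regret (\<lambda>s u. inner (c s) u) x T u \<le> alt_regret (\<lambda>s u. inner (c s) u) x T m) \<and>
      alt_regret (\<lambda>s u. inner (c s) u) x T m \<le> 8 * ln (real CARD('d))" for T
    using polytope_hedge_regret[OF finite_Basis nonempty_Basis, of c x T,
        folded prob_simplex_eq_convex_hull, OF _ inner_bound x] \<open>c 0 = 0\<close>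
    by simp
qed

end
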